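(* Let $X$ and $Y$ be real Banach spaces with origins $\theta_X,\theta_Y$, let $K\subseteq Y$ be a closed convex pointed cone with $K\neq\{\theta_Y\}$, let $A\subseteq X$ be a nonempty convex open set, and let $T:A\to Y$ be a mapping. Let $\bar x\in A$ and $v\in X\setminus\{\theta_X\}$. If $T$ has a $\preccurlyeq_K$-maximum value (or a $\preccurlyeq_K$-minimum value) in $A$ at $\bar x$ along direction $v$, and $T$ is Gâteaux directionally differentiable at $\bar x$ along direction $v$, then $T'(\bar x,v)=\theta_Y$.
   Context: The partial order on $Y$ is $y_1\preccurlyeq_K y_2\iff y_2-y_1\in K$; pointed means $K\cap(-K)=\{\theta_Y\}$. $T$ is Gâteaux directionally differentiable at $\bar x$ along $v\neq\theta_X$ if the norm limit $T'(\bar x,v)=\lim_{t\to0}\frac{T(\bar x+tv)-T(\bar x)}{t}$ ($t$ real) exists in $Y$. $T$ has a $\preccurlyeq_K$-maximum value in $A$ at $\bar x$ along direction $v$ if $T(\bar x+tv)\preccurlyeq_K T(\bar x)$ for all real $t$ with $\bar x+tv\in A$; it has a $\preccurlyeq_K$-minimum value there if $T(\bar x)\preccurlyeq_K T(\bar x+tv)$ for all such $t$. *)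

theory Defs
  imports "HOL-Analysis.Analysis"
begin

definition pointed :: "'a::real_vector set \<Rightarrow> bool"
  where "pointed K \<longleftrightarrow> K \<inter> uminus ` K = {0}"

definition cone_le :: "'a::real_vector set \<Rightarrow> 'a \<Rightarrow> 'a \<Rightarrow> bool"
  where "cone_le K y1 y2 \<longleftrightarrow> y2 - y1 \<in> K"

text \<open>
  A mapping from \<open>A\<close> to \<open>Y\<close> is represented by a total function of which only the values on
  \<open>A\<close> matter. This applies to the difference quotient as well: for open \<open>A\<close> and \<open>x \<in> A\<close>, the
  point \<open>x + t *\<^sub>R v\<close> lies in \<open>A\<close> for all small \<open>t\<close>, so neither the existence nor the value of
  the two-sided limit depends on values of \<open>T\<close> outside \<open>A\<close>.
\<close>

definition gateaux_quotient ::
    "('a::real_normed_vector \<Rightarrow> 'b::real_normed_vector) \<Rightarrow> 'a \<Rightarrow> 'a \<Rightarrow> real \<Rightarrow> 'b"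
  where "gateaux_quotient T x v t = (T (x + t *\<^sub>R v) - T x) /\<^sub>R t"

definition gateaux_dir_differentiable ::
    "('a::real_normed_vector \<Rightarrow> 'b::real_normed_vector) \<Rightarrow> 'a \<Rightarrow> 'a \<Rightarrow> bool"
  where "gateaux_dir_differentiable T x v \<longleftrightarrow>
    (\<exists>D. (gateaux_quotient T x v \<longlongrightarrow> D) (at 0))"

text \<open>Only meaningful if \<open>gateaux_dir_differentiable T x v\<close> holds; unspecified otherwise.\<close>

definition gateaux_dir_deriv ::
    "('a::real_normed_vector \<Rightarrow> 'b::real_normed_vector) \<Rightarrow> 'a \<Rightarrow> 'a \<Rightarrow> 'b"
  where "gateaux_dir_deriv T x v = Lim (at 0) (gateaux_quotient T x v)"

definition has_max_value_along ::
    "'b::real_vector set \<Rightarrow> ('a::real_vector \<Rightarrow> 'b) \<Rightarrow> 'a set \<Rightarrow> 'a \<Rightarrow> 'a \<Rightarrow> bool"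
  where "has_max_value_along K T A x v \<longleftrightarrow>
    (\<forall>t::real. x + t *\<^sub>R v \<in> A \<longrightarrow> cone_le K (T (x + t *\<^sub>R v)) (T x))"

definition has_min_value_along ::
    "'b::real_vector set \<Rightarrow> ('a::real_vector \<Rightarrow> 'b) \<Rightarrow> 'a set \<Rightarrow> 'a \<Rightarrow> 'a \<Rightarrow> bool"
  where "has_min_value_along K T A x v \<longleftrightarrow>
    (\<forall>t::real. x + t *\<^sub>R v \<in> A \<longrightarrow> cone_le K (T x) (T (x + t *\<^sub>R v)))"

end

theory Submission
  imports Defs
begin

text \<open>At an extremum along \<open>v\<close>, the increment of \<open>T\<close>, up to a global
  sign, lies in \<open>K\<close> for all small t of either sign. Since \<open>K\<close> is a cone,
  dividing by t > 0 stays in \<open>K\<close>, while dividing by t < 0 lands in -\<open>K\<close>.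
  Both one-sided limits equal the derivative \<open>D\<close>, so closedness puts \<open>D\<close>
  in \<open>K\<close> and in -\<open>K\<close>, and pointedness forces \<open>D\<close> = 0.\<close>

text \<open>Here \<open>f\<close> stands for the increment of \<open>T\<close> at a minimum and for
  its negative at a maximum, so one argument serves both cases.\<close>

lemma cone_valued_two_sided_derivative:
  fixes f :: "real \<Rightarrow> 'y::real_normed_vector"
  assumes "closed K" and "conic K"
    and ev: "\<forall>\<^sub>F t in at 0. f t \<in> K"
    and lim: "((\<lambda>t. f t /\<^sub>R t) \<longlongrightarrow> D) (at 0)"
  shows "D \<in> K \<and> - D \<in> K"
proof
  have R: "\<forall>\<^sub>F t in at_right 0. f t \<in> K" and L: "\<forall>\<^sub>F t in at_left 0. f t \<in> K"
    using ev by (simp_all add: eventually_at_split)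
  have limR: "((\<lambda>t. f t /\<^sub>R t) \<longlongrightarrow> D) (at_right 0)"
    and limL: "((\<lambda>t. f t /\<^sub>R t) \<longlongrightarrow> D) (at_left 0)"
    using lim by (simp_all add: filterlim_at_split)
  have "\<forall>\<^sub>F t in at_right 0. f t /\<^sub>R t \<in> K"
    using R eventually_at_right_less[of "0::real"]
    by eventually_elim (simp add: conicD[OF \<open>conic K\<close>])
  then show "D \<in> K"
    by (rule Lim_in_closed_set[OF \<open>closed K\<close> _ _ limR]) simp
  have "\<forall>\<^sub>F t::real in at_left 0. t < 0"
    by (simp add: eventually_at_filter)
  with L have "\<forall>\<^sub>F t in at_left 0. - (f t /\<^sub>R t) \<in> K"
  proof eventually_elim
    case (elim t)
    \<comment> \<open>Conicity allows only nonnegative scalars; for t < 0 the minus sign is absorbed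
      into the positive factor -1/t.\<close>
    then have "(- inverse t) *\<^sub>R f t \<in> K"
      by (intro conicD[OF \<open>conic K\<close>]) auto
    then show ?case by simp
  qed
  then show "- D \<in> K"
    by (rule Lim_in_closed_set[OF \<open>closed K\<close> _ _ tendsto_minus[OF limL]]) simp
qed

theorem theorem2p4:
  fixes K :: "'y::banach set"
    and A :: "'x::banach set"
    and T :: "'x \<Rightarrow> 'y"
    and x v :: 'x
  assumes "closed K" and "convex_cone K" and "pointed K" and "K \<noteq> {0}"
    and "A \<noteq> {}" and "convex A" and "open A"
    and "x \<in> A" and "v \<noteq> 0"
    and "has_max_value_along K T A x v \<or> has_min_value_along K T A x v"
    and "gateaux_dir_differentiable T x v"
  shows "gateaux_dir_deriv T x v = 0"
proof -
  obtain D where D: "(gateaux_quotient T x v \<longlongrightarrow> D) (at 0)"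
    using assms(11) by (auto simp: gateaux_dir_differentiable_def)
  have "conic K"
    using assms(2) by (simp add: convex_cone_def)
  \<comment> \<open>Extremality speaks only of points of \<open>A\<close>; openness of
    \<open>A\<close> and continuity of the line make it available for all small t.\<close>
  have "((\<lambda>t. x + t *\<^sub>R v) \<longlongrightarrow> x + 0 *\<^sub>R v) (at (0::real))"
    by (intro tendsto_intros)
  then have inA: "\<forall>\<^sub>F t in at (0::real). x + t *\<^sub>R v \<in> A"
    using topological_tendstoD[OF _ \<open>open A\<close>] \<open>x \<in> A\<close> by fastforce
  have lim: "((\<lambda>t. (T (x + t *\<^sub>R v) - T x) /\<^sub>R t) \<longlongrightarrow> D) (at 0)"
    using D by (simp add: gateaux_quotient_def [abs_def])
  have "D \<in> K \<and> - D \<in> K"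
    using assms(10)
  proof
    assume "has_max_value_along K T A x v"
    then have ev: "\<forall>\<^sub>F t in at 0. T x - T (x + t *\<^sub>R v) \<in> K"
      using inA by (auto simp: has_max_value_along_def cone_le_def elim: eventually_mono)
    \<comment> \<open>The reversed increment has derivative -\<open>D\<close>; the lemma's
      conclusion is symmetric under \<open>D\<close> to -\<open>D\<close>, so the sign is
      harmless.\<close>
    have "((\<lambda>t. (T x - T (x + t *\<^sub>R v)) /\<^sub>R t) \<longlongrightarrow> - D) (at 0)"
      using tendsto_minus[OF lim] by (simp flip: scaleR_minus_right)
    from cone_valued_two_sided_derivative[OF \<open>closed K\<close> \<open>conic K\<close> ev this]
    show ?thesis by simp
  next
    assume "has_min_value_along K T A x v"
    then have ev: "\<forall>\<^sub>F t in at 0. T (x + t *\<^sub>R v) - T x \<in> K"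
      using inA by (auto simp: has_min_value_along_def cone_le_def elim: eventually_mono)
    from cone_valued_two_sided_derivative[OF \<open>closed K\<close> \<open>conic K\<close> ev lim]
    show ?thesis .
  qed
  then have "D \<in> K \<inter> uminus ` K"
    by (auto intro: image_eqI[of _ _ "- D"])
  then have "D = 0"
    using \<open>pointed K\<close> unfolding pointed_def by blast
  \<comment> \<open>Uniqueness of limits identifies the value chosen by \<open>Lim\<close> with
    \<open>D\<close>.\<close>
  with D show ?thesis
    unfolding gateaux_dir_deriv_def by (simp add: tendsto_Lim)
qed

end
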